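(* Let $f:G_1\to G_2$ be a homomorphism of groups and let $Q$ be a quasi-normal subgroup of $G_2$. Then $f^{-1}(Q)$ is quasi-normal in $G_1$. Furthermore ($Q\cap f(G_1)$ being quasi-normal in $f(G_1)$), commensuration data for $(g_1,f^{-1}(Q),G_1)$ and for $(f(g_1),Q\cap f(G_1),f(G_1))$, for all $g_1\in G_1$, can be chosen so that for all $g_1\in G_1$: 1) $f(A(g_1,f^{-1}(Q),G_1))=A(f(g_1),Q\cap f(G_1),f(G_1))$; 2) $f(\alpha_{(g_1,f^{-1}(Q),G_1)}(q'))=\alpha_{(f(g_1),Q\cap f(G_1),f(G_1))}(f(q'))$ for all $q'\in f^{-1}(Q)$; 3) $f(\beta_{(g_1,f^{-1}(Q),G_1)}(q'))=\beta_{(f(g_1),Q\cap f(G_1),f(G_1))}(f(q'))$ for all $q'\in f^{-1}(Q)$. (When $f$ is an epimorphism, $Q\cap f(G_1)=Q$ and $f(G_1)=G_2$ in 1), 2), 3).)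
   Context: For a subgroup $H$ of a group $G$, the commensurator of $H$ in $G$ is $Comm(H,G)=\{g\in G : gHg^{-1}\cap H \text{ has finite index in both } H \text{ and } gHg^{-1}\}$. A subgroup $Q$ of $G$ is quasi-normal in $G$ if $Comm(Q,G)=G$. For $g\in Comm(H,G)$, commensuration data for $(g,H,G)$ means a finite subset $A(g,H,G)$ of $HgH$ and functions $\alpha_{(g,H,G)}:H\to A(g,H,G)$ and $\beta_{(g,H,G)}:H\to (A(g,H,G))^{-1}$ such that: for each $h\in H$, $h\,\alpha_{(g,H,G)}(h)\in gH$ and $gh\,\beta_{(g,H,G)}(h)\in H$; $\mathrm{image}(\alpha_{(g,H,G)})\cup(\mathrm{image}(\beta_{(g,H,G)}))^{-1}=A(g,H,G)$; and for each $a\in A(g,H,G)$ there are $h_1,h_2\in H$ with $h_1a\in gH$ and $gh_2a^{-1}\in H$. Such data exist for every $g\in Comm(H,G)$ but are not unique. The data for $(f(g_1),Q\cap f(G_1),f(G_1))$ depend only on the element $f(g_1)$. *)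

theory Defs
  imports "HOL-Algebra.Coset"
begin

text \<open>Finiteness of the index of \<open>K\<close> in \<open>H\<close>, for subgroups \<open>K \<subseteq> H\<close> of \<open>G\<close>: the cosets are taken
  inside \<open>H\<close>, regarded as a group in its own right.\<close>

definition finite_index :: "('a, 'm) monoid_scheme \<Rightarrow> 'a set \<Rightarrow> 'a set \<Rightarrow> bool" where
  "finite_index G K H \<longleftrightarrow> finite (rcosets\<^bsub>G\<lparr>carrier := H\<rparr>\<^esub> K)"

definition conj_set :: "('a, 'm) monoid_scheme \<Rightarrow> 'a \<Rightarrow> 'a set \<Rightarrow> 'a set" where
  "conj_set G g H = (g <#\<^bsub>G\<^esub> H) #>\<^bsub>G\<^esub> inv\<^bsub>G\<^esub> g"

definition Comm :: "'a set \<Rightarrow> ('a, 'm) monoid_scheme \<Rightarrow> 'a set" where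
  "Comm H G = {g \<in> carrier G.
     finite_index G (conj_set G g H \<inter> H) H \<and>
     finite_index G (conj_set G g H \<inter> H) (conj_set G g H)}"

definition quasi_normal :: "'a set \<Rightarrow> ('a, 'm) monoid_scheme \<Rightarrow> bool" where
  "quasi_normal Q G \<longleftrightarrow> subgroup Q G \<and> Comm Q G = carrier G"

text \<open>The functions \<open>\<alpha>\<close> and \<open>\<beta>\<close> have domain \<open>H\<close>; their values outside \<open>H\<close> are irrelevant, and
  images are images of \<open>H\<close>.\<close>

definition commensuration_data ::
  "'a \<Rightarrow> 'a set \<Rightarrow> ('a, 'm) monoid_scheme \<Rightarrow> 'a set \<Rightarrow> ('a \<Rightarrow> 'a) \<Rightarrow> ('a \<Rightarrow> 'a) \<Rightarrow> bool" where
  "commensuration_data g H G A \<alpha> \<beta> \<longleftrightarrow>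
     g \<in> Comm H G \<and>
     finite A \<and> A \<subseteq> H <#>\<^bsub>G\<^esub> (g <#\<^bsub>G\<^esub> H) \<and>
     \<alpha> \<in> H \<rightarrow> A \<and> \<beta> \<in> H \<rightarrow> set_inv\<^bsub>G\<^esub> A \<and>
     (\<forall>h\<in>H. h \<otimes>\<^bsub>G\<^esub> \<alpha> h \<in> g <#\<^bsub>G\<^esub> H \<and> g \<otimes>\<^bsub>G\<^esub> h \<otimes>\<^bsub>G\<^esub> \<beta> h \<in> H) \<and>
     \<alpha> ` H \<union> set_inv\<^bsub>G\<^esub> (\<beta> ` H) = A \<and>
     (\<forall>a\<in>A. \<exists>h\<^sub>1\<in>H. \<exists>h\<^sub>2\<in>H. h\<^sub>1 \<otimes>\<^bsub>G\<^esub> a \<in> g <#\<^bsub>G\<^esub> H \<and> g \<otimes>\<^bsub>G\<^esub> h\<^sub>2 \<otimes>\<^bsub>G\<^esub> inv\<^bsub>G\<^esub> a \<in> H)"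

end

theory Submission
  imports Defs
begin

text \<open>Membership of \<open>g\<close> in the commensurator of \<open>H\<close> says that \<open>HgH\<close> consists of finitely many left
  and finitely many right cosets of \<open>H\<close>. Coset equalities are pulled back along \<open>f\<close>, so
  quasi-normality passes to the full preimage of \<open>Q\<close>; applied to the inclusion of \<open>f(G\<^sub>1)\<close> this also
  covers \<open>Q \<inter> f(G\<^sub>1)\<close>. Data in \<open>f(G\<^sub>1)\<close> are given by coset representatives, and data
  in \<open>G\<^sub>1\<close> are obtained by composing with a section of \<open>f\<close>: as \<open>f\<^sup>-\<^sup>1(Q)\<close> is a full preimage, every
  condition on the lifted elements can be checked after applying \<open>f\<close>.\<close>

section \<open>Finiteness of images, compared through fibres\<close>

lemma finite_image_coarser:
  assumes "finite (F ` S)"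
    and "\<And>x y. x \<in> S \<Longrightarrow> y \<in> S \<Longrightarrow> F x = F y \<Longrightarrow> G x = G y"
  shows "finite (G ` S)"
proof -
  \<comment> \<open>\<open>inv_into S F\<close> picks one point in each fibre of \<open>F\<close>;
    as \<open>G\<close> is constant on these fibres, it factors through \<open>F\<close> on
    \<open>S\<close>.\<close>
  have "G x = G (inv_into S F (F x))" if "x \<in> S" for x
    using that by (intro assms(2)) (auto simp: inv_into_into f_inv_into_f)
  then have "G ` S \<subseteq> (\<lambda>c. G (inv_into S F c)) ` F ` S"
    by (auto simp: image_iff)
  then show ?thesis
    by (meson assms(1) finite_imageI finite_subset)
qed

text \<open>Each function factors through the other on \<open>S\<close>. This compares families of
  cosets of different subgroups over one index set, with no bijection written down.\<close>

lemma finite_image_same_kernel: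
  assumes "\<And>x y. x \<in> S \<Longrightarrow> y \<in> S \<Longrightarrow> F x = F y \<longleftrightarrow> G x = G y"
  shows "finite (F ` S) \<longleftrightarrow> finite (G ` S)"
  using finite_image_coarser[of F S G] finite_image_coarser[of G S F] assms by blast

section \<open>Cosets and conjugates of a subgroup\<close>

context group
begin

lemma l_inv_cancel: "x \<in> carrier G \<Longrightarrow> y \<in> carrier G \<Longrightarrow> inv x \<otimes> (x \<otimes> y) = y"
  and r_inv_cancel: "x \<in> carrier G \<Longrightarrow> y \<in> carrier G \<Longrightarrow> x \<otimes> (inv x \<otimes> y) = y"
  by (simp_all add: m_assoc[symmetric])

lemma r_coset_eq_iff:
  assumes "subgroup H G" "a \<in> carrier G" "b \<in> carrier G"
  shows "H #> a = H #> b \<longleftrightarrow> a \<otimes> inv b \<in> H"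
proof
  interpret H: subgroup H G by fact
  assume "H #> a = H #> b"
  then have "a \<in> H #> b"
    using rcos_self[OF assms(2,1)] by simp
  then obtain h where "h \<in> H" "a = h \<otimes> b"
    by (auto simp: r_coset_def)
  then show "a \<otimes> inv b \<in> H"
    using assms by (simp add: m_assoc)
next
  interpret H: subgroup H G by fact
  assume "a \<otimes> inv b \<in> H"
  then have "a \<in> H #> b"
    using assms by (intro H.rcos_module_rev) (auto intro: group_axioms)
  then show "H #> a = H #> b"
    using repr_independence[OF _ assms(3,1)] by metis
qed

lemma l_coset_iff:
  assumes "subgroup H G" "a \<in> carrier G" "x \<in> carrier G"
  shows "x \<in> a <# H \<longleftrightarrow> inv a \<otimes> x \<in> H"
proof
  interpret H: subgroup H G by fact
  show "x \<in> a <# H \<Longrightarrow> inv a \<otimes> x \<in> H"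
    using assms by (auto simp: l_coset_def m_assoc[symmetric])
  assume "inv a \<otimes> x \<in> H"
  moreover have "x = a \<otimes> (inv a \<otimes> x)"
    using assms by (simp add: m_assoc[symmetric])
  ultimately show "x \<in> a <# H"
    unfolding l_coset_def by blast
qed

lemma l_coset_eq_iff:
  assumes "subgroup H G" "a \<in> carrier G" "b \<in> carrier G"
  shows "a <# H = b <# H \<longleftrightarrow> inv a \<otimes> b \<in> H"
proof -
  interpret H: subgroup H G by fact
  have "b \<in> b <# H"
    using assms by (simp add: l_coset_iff)
  moreover have "a <# H = b <# H" if "b \<in> a <# H"
    using l_repr_independence[OF that assms(2,1)] .
  ultimately show ?thesis
    using l_coset_iff[OF assms] by blast
qed

lemma conj_set_iff:
  assumes "subgroup H G" "g \<in> carrier G" "x \<in> carrier G"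
  shows "x \<in> conj_set G g H \<longleftrightarrow> inv g \<otimes> x \<otimes> g \<in> H"
proof
  interpret H: subgroup H G by fact
  show "x \<in> conj_set G g H \<Longrightarrow> inv g \<otimes> x \<otimes> g \<in> H"
    using assms by (auto simp: conj_set_def l_coset_def r_coset_def m_assoc l_inv_cancel)
  assume "inv g \<otimes> x \<otimes> g \<in> H"
  moreover have "x = g \<otimes> (inv g \<otimes> x \<otimes> g) \<otimes> inv g"
    using assms by (simp add: m_assoc r_inv_cancel)
  ultimately show "x \<in> conj_set G g H"
    unfolding conj_set_def l_coset_def r_coset_def by blast
qed

lemma conj_set_eq: "conj_set G g H = (\<lambda>h. g \<otimes> h \<otimes> inv g) ` H"
  by (auto simp: conj_set_def l_coset_def r_coset_def)

lemma conj_set_subset: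
  assumes "H \<subseteq> carrier G" "g \<in> carrier G"
  shows "conj_set G g H \<subseteq> carrier G"
  using assms by (auto simp: conj_set_eq)

lemma subgroup_conj_set:
  assumes "subgroup H G" "g \<in> carrier G"
  shows "subgroup (conj_set G g H) G"
proof -
  interpret H: subgroup H G by fact
  have sub: "conj_set G g H \<subseteq> carrier G"
    using assms H.subset by (simp add: conj_set_subset)
  show ?thesis
  proof (rule subgroup.intro[OF sub])
    fix x y assume "x \<in> conj_set G g H" "y \<in> conj_set G g H"
    then obtain h k where "h \<in> H" "k \<in> H" "x = g \<otimes> h \<otimes> inv g" "y = g \<otimes> k \<otimes> inv g"
      by (auto simp: conj_set_eq)
    then have "x \<otimes> y = g \<otimes> (h \<otimes> k) \<otimes> inv g" "h \<otimes> k \<in> H"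
      using assms by (simp_all add: m_assoc l_inv_cancel)
    then show "x \<otimes> y \<in> conj_set G g H"
      by (auto simp: conj_set_eq)
  next
    show "\<one> \<in> conj_set G g H"
      using assms by (simp add: conj_set_iff)
  next
    fix x assume "x \<in> conj_set G g H"
    then obtain h where "h \<in> H" "x = g \<otimes> h \<otimes> inv g"
      by (auto simp: conj_set_eq)
    then have "inv x = g \<otimes> inv h \<otimes> inv g" "inv h \<in> H"
      using assms by (simp_all add: inv_mult_group m_assoc)
    then show "inv x \<in> conj_set G g H"
      by (auto simp: conj_set_eq)
  qed
qed

section \<open>The commensurator and commensuration data in terms of cosets\<close>

lemma finite_index_iff: "finite_index G K H \<longleftrightarrow> finite ((\<lambda>h. K #> h) ` H)"
  \<comment> \<open>Replacing the carrier leaves the multiplication alone, so the cosets inside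
    \<open>H\<close> are those computed in \<open>G\<close>.\<close>
  by (simp add: finite_index_def RCOSETS_def r_coset_def UNION_singleton_eq_range)

text \<open>Cosets of the intersection \<open>K\<close> in \<open>H\<close> correspond to the left
  cosets of \<open>H\<close> in HgH, those in the conjugate to the right cosets. These are the
  cosets from which commensuration data pick representatives.\<close>

lemma Comm_iff:
  assumes "subgroup H G"
  shows "g \<in> Comm H G \<longleftrightarrow> g \<in> carrier G \<and>
    finite ((\<lambda>h. inv h \<otimes> g <# H) ` H) \<and> finite ((\<lambda>h. H #> g \<otimes> h) ` H)"
proof (cases "g \<in> carrier G")
  case g: True
  interpret H: subgroup H G by fact
  define K where "K = conj_set G g H \<inter> H"
  have K: "subgroup K G"
    unfolding K_def using subgroup_conj_set[OF assms g] assms by (rule subgroups_Inter_pair)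
  \<comment> \<open>The quotient \<open>h \<otimes> inv k\<close> is in \<open>H\<close> anyway, so
    only membership in the conjugate is at stake. Conjugating back turns it into an equality of left
    cosets.\<close>
  have "K #> h = K #> k \<longleftrightarrow> inv h \<otimes> g <# H = inv k \<otimes> g <# H" if "h \<in> H" "k \<in> H" for h k
  proof -
    have "K #> h = K #> k \<longleftrightarrow> inv g \<otimes> (h \<otimes> inv k) \<otimes> g \<in> H"
      using that g assms K by (simp add: r_coset_eq_iff) (simp add: K_def conj_set_iff)
    also have "inv g \<otimes> (h \<otimes> inv k) \<otimes> g = inv (inv h \<otimes> g) \<otimes> (inv k \<otimes> g)"
      using that g by (simp add: inv_mult_group m_assoc)
    finally show ?thesis
      using that g assms by (simp add: l_coset_eq_iff)
  qed
  then have 1: "finite_index G K H \<longleftrightarrow> finite ((\<lambda>h. inv h \<otimes> g <# H) ` H)"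
    unfolding finite_index_iff by (rule finite_image_same_kernel)
  \<comment> \<open>Here the roles are exchanged: the quotient \<open>x\<close> is in the conjugate
    anyway, so only membership in \<open>H\<close> is at stake, and the trailing factors
    \<open>inv g\<close> cancel in \<open>x\<close>.\<close>
  have "K #> g \<otimes> h \<otimes> inv g = K #> g \<otimes> k \<otimes> inv g \<longleftrightarrow> H #> g \<otimes> h = H #> g \<otimes> k"
    if "h \<in> H" "k \<in> H" for h k
  proof -
    define x where "x = g \<otimes> h \<otimes> inv g \<otimes> inv (g \<otimes> k \<otimes> inv g)"
    have x: "x = g \<otimes> h \<otimes> inv (g \<otimes> k)" "x \<in> carrier G"
      using that g by (simp_all add: x_def inv_mult_group m_assoc l_inv_cancel)
    have "inv g \<otimes> x \<otimes> g = h \<otimes> inv k"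
      using that g by (simp add: x inv_mult_group m_assoc l_inv_cancel)
    then have "x \<in> conj_set G g H"
      using that g assms x(2) by (simp add: conj_set_iff)
    then have "x \<in> K \<longleftrightarrow> x \<in> H"
      by (simp add: K_def)
    then show ?thesis
      using that g assms K x(1) x_def by (simp add: r_coset_eq_iff)
  qed
  then have "finite ((\<lambda>h. K #> g \<otimes> h \<otimes> inv g) ` H) \<longleftrightarrow> finite ((\<lambda>h. H #> g \<otimes> h) ` H)"
    by (rule finite_image_same_kernel)
  then have 2: "finite_index G K (conj_set G g H) \<longleftrightarrow> finite ((\<lambda>h. H #> g \<otimes> h) ` H)"
    by (simp add: finite_index_iff conj_set_eq image_image)
  show ?thesis
    using g 1 2 by (simp add: Comm_def K_def)
qed (simp add: Comm_def)

text \<open>The defining conditions ask that \<open>\<alpha> h\<close> lie in the left coset of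
  \<open>inv h \<otimes> g\<close> and the inverse of \<open>\<beta> h\<close> in the right coset of
  \<open>g \<otimes> h\<close>. So one representative is fixed in each of these finitely many
  cosets.\<close>

lemma commensuration_data_exists:
  assumes "subgroup H G" "g \<in> Comm H G"
  obtains A \<alpha> \<beta> where "commensuration_data g H G A \<alpha> \<beta>"
proof -
  interpret H: subgroup H G by fact
  have g: "g \<in> carrier G"
    and fin: "finite ((\<lambda>h. inv h \<otimes> g <# H) ` H)" "finite ((\<lambda>h. H #> g \<otimes> h) ` H)"
    using assms Comm_iff by blast+
  \<comment> \<open>\<open>r\<close> chooses from the coset as a set, so equal cosets get the same
    representative; finiteness of \<open>A\<close> rests on this.\<close>
  define r where "r C = (SOME x. x \<in> C)" for C :: "'a set"
  define \<alpha> where "\<alpha> h = r (inv h \<otimes> g <# H)" for h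
  define b where "b h = r (H #> g \<otimes> h)" for h
  define \<beta> where "\<beta> h = inv (b h)" for h
  define A where "A = \<alpha> ` H \<union> b ` H"
  have \<alpha>: "\<exists>k\<in>H. \<alpha> h = inv h \<otimes> g \<otimes> k" if "h \<in> H" for h
  proof -
    have "inv h \<otimes> g \<in> inv h \<otimes> g <# H"
      using that g assms by (simp add: l_coset_iff)
    then have "\<alpha> h \<in> inv h \<otimes> g <# H"
      unfolding \<alpha>_def r_def by (rule someI)
    then show ?thesis
      by (auto simp: l_coset_def)
  qed
  have b: "\<exists>k\<in>H. b h = k \<otimes> (g \<otimes> h)" if "h \<in> H" for h
  proof -
    have "g \<otimes> h \<in> H #> g \<otimes> h"
      using that g assms by (simp add: rcos_self)
    then have "b h \<in> H #> g \<otimes> h"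
      unfolding b_def r_def by (rule someI)
    then show ?thesis
      by (auto simp: r_coset_def)
  qed
  \<comment> \<open>This factorization yields both the inclusion of \<open>A\<close> in HgH and the
    witnesses for the last condition on data.\<close>
  have A: "\<exists>h\<in>H. \<exists>k\<in>H. a = h \<otimes> (g \<otimes> k)" if "a \<in> A" for a
  proof -
    from that consider h where "h \<in> H" "a = \<alpha> h" | h where "h \<in> H" "a = b h"
      by (auto simp: A_def)
    then show ?thesis
    proof cases
      case 1
      then obtain k where "k \<in> H" "a = inv h \<otimes> (g \<otimes> k)"
        using \<alpha>[of h] g by (auto simp: m_assoc)
      with 1 show ?thesis by blast
    next
      case 2
      then show ?thesis using b by blast
    qed
  qed
  have Acl: "a \<in> carrier G" if "a \<in> A" for a
    using A[OF that] g by auto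
  have "commensuration_data g H G A \<alpha> \<beta>"
    unfolding commensuration_data_def
  proof (intro conjI ballI)
    have "\<alpha> ` H = r ` (\<lambda>h. inv h \<otimes> g <# H) ` H" "b ` H = r ` (\<lambda>h. H #> g \<otimes> h) ` H"
      by (auto simp: \<alpha>_def b_def)
    then show "finite A"
      using fin by (simp add: A_def)
    show "A \<subseteq> H <#> (g <# H)"
      using A by (fastforce simp: set_mult_def l_coset_def)
    show "\<alpha> \<in> H \<rightarrow> A" "\<beta> \<in> H \<rightarrow> set_inv A"
      by (auto simp: A_def \<beta>_def SET_INV_def)
    have "set_inv (\<beta> ` H) = b ` H"
      using Acl by (auto simp: SET_INV_def \<beta>_def A_def)
    then show "\<alpha> ` H \<union> set_inv (\<beta> ` H) = A"
      by (simp add: A_def)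
  next
    fix h assume h: "h \<in> H"
    obtain k where "k \<in> H" "\<alpha> h = inv h \<otimes> g \<otimes> k"
      using \<alpha>[OF h] by blast
    then show "h \<otimes> \<alpha> h \<in> g <# H"
      using h g by (auto simp: l_coset_def m_assoc r_inv_cancel)
    obtain k where "k \<in> H" "b h = k \<otimes> (g \<otimes> h)"
      using b[OF h] by blast
    then have "g \<otimes> h \<otimes> \<beta> h = inv k" "k \<in> H"
      using h g by (simp_all add: \<beta>_def inv_mult_group m_assoc r_inv_cancel)
    then show "g \<otimes> h \<otimes> \<beta> h \<in> H"
      by simp
  next
    fix a assume "a \<in> A"
    then obtain h k where hk: "h \<in> H" "k \<in> H" and a: "a = h \<otimes> (g \<otimes> k)"
      using A by blast
    \<comment> \<open>With a = hgk, stripping \<open>h\<close> on the left leaves an element of gH,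
      and dividing gk by \<open>a\<close> leaves \<open>inv h\<close>. So \<open>inv h\<close> and
      \<open>k\<close> are the witnesses.\<close>
    have "inv h \<otimes> a = g \<otimes> k" "g \<otimes> k \<otimes> inv a = inv h"
      using hk g by (simp_all add: a inv_mult_group m_assoc l_inv_cancel r_inv_cancel)
    then show "\<exists>h\<^sub>1\<in>H. \<exists>h\<^sub>2\<in>H. h\<^sub>1 \<otimes> a \<in> g <# H \<and> g \<otimes> h\<^sub>2 \<otimes> inv a \<in> H"
      using hk by (intro bexI[of _ "inv h"] bexI[of _ k]) (auto simp: l_coset_def)
  qed (fact assms)
  then show thesis ..
qed

end

section \<open>Preimages of subgroups and lifting of commensuration data\<close>

context group_hom
begin

lemma subgroup_preimage:
  assumes "subgroup Q H"
  shows "subgroup {x \<in> carrier G. h x \<in> Q} G"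
proof -
  interpret Q: subgroup Q H by fact
  show ?thesis
    by (rule subgroup.intro) auto
qed

text \<open>Two cosets agree when a quotient of representatives lies in the subgroup, and for the
  preimage this is tested after applying \<open>h\<close>. So cosets of the preimage are determined
  by the corresponding cosets of \<open>Q\<close>.\<close>

lemma Comm_preimage:
  assumes "subgroup Q H" "g \<in> carrier G" "h g \<in> Comm Q H"
  shows "g \<in> Comm {x \<in> carrier G. h x \<in> Q} G"
proof -
  let ?P = "{x \<in> carrier G. h x \<in> Q}"
  have P: "subgroup ?P G"
    using assms(1) by (rule subgroup_preimage)
  \<comment> \<open>\<open>Q\<close> may reach outside the image of \<open>h\<close>. An inclusion
    suffices, since it selects a subfamily of a finite family of cosets.\<close>
  have hP: "h ` ?P \<subseteq> Q"
    by auto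
  have fin: "finite ((\<lambda>y. inv\<^bsub>H\<^esub> y \<otimes>\<^bsub>H\<^esub> h g <#\<^bsub>H\<^esub> Q) ` Q)"
    "finite ((\<lambda>y. Q #>\<^bsub>H\<^esub> h g \<otimes>\<^bsub>H\<^esub> y) ` Q)"
    using assms H.Comm_iff by blast+
  have "finite ((\<lambda>x. inv\<^bsub>H\<^esub> h x \<otimes>\<^bsub>H\<^esub> h g <#\<^bsub>H\<^esub> Q) ` ?P)"
    using finite_subset[OF image_mono[OF hP] fin(1)] by (simp add: image_image)
  then have 1: "finite ((\<lambda>x. inv x \<otimes> g <# ?P) ` ?P)"
    by (rule finite_image_coarser) (use assms P in \<open>simp add: H.l_coset_eq_iff G.l_coset_eq_iff\<close>)
  have "finite ((\<lambda>x. Q #>\<^bsub>H\<^esub> h g \<otimes>\<^bsub>H\<^esub> h x) ` ?P)"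
    using finite_subset[OF image_mono[OF hP] fin(2)] by (simp add: image_image)
  then have 2: "finite ((\<lambda>x. ?P #> g \<otimes> x) ` ?P)"
    by (rule finite_image_coarser) (use assms P in \<open>simp add: H.r_coset_eq_iff G.r_coset_eq_iff\<close>)
  show ?thesis
    using G.Comm_iff[OF P] 1 2 assms(2) by blast
qed

lemma quasi_normal_preimage:
  assumes "quasi_normal Q H"
  shows "quasi_normal {x \<in> carrier G. h x \<in> Q} G"
proof -
  have "subgroup Q H" "Comm Q H = carrier H"
    using assms by (simp_all add: quasi_normal_def)
  then have "carrier G \<subseteq> Comm {x \<in> carrier G. h x \<in> Q} G"
    using Comm_preimage by auto
  then show ?thesis
    using subgroup_preimage[OF \<open>subgroup Q H\<close>] by (auto simp: quasi_normal_def Comm_def)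
qed

lemma commensuration_data_lift:
  assumes Q: "subgroup Q H" and g: "g \<in> carrier G"
    and data: "commensuration_data (h g) Q H A \<alpha> \<beta>"
    and s: "\<And>y. y \<in> carrier H \<Longrightarrow> s y \<in> carrier G \<and> h (s y) = y"
  shows "commensuration_data g {x \<in> carrier G. h x \<in> Q} G
    (s ` A) (\<lambda>x. s (\<alpha> (h x))) (\<lambda>x. inv (s (inv\<^bsub>H\<^esub> \<beta> (h x))))"
    and "h ` s ` A = A"
    and "\<And>x. x \<in> carrier G \<Longrightarrow> h x \<in> Q \<Longrightarrow> h (s (\<alpha> (h x))) = \<alpha> (h x)"
    and "\<And>x. x \<in> carrier G \<Longrightarrow> h x \<in> Q \<Longrightarrow> h (inv (s (inv\<^bsub>H\<^esub> \<beta> (h x)))) = \<beta> (h x)"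
proof -
  interpret Q: subgroup Q H by fact
  define P where "P = {x \<in> carrier G. h x \<in> Q}"
  have P: "subgroup P G"
    unfolding P_def using Q by (rule subgroup_preimage)
  have Comm: "h g \<in> Comm Q H" and fin: "finite A"
    and sub: "A \<subseteq> Q <#>\<^bsub>H\<^esub> (h g <#\<^bsub>H\<^esub> Q)"
    and \<alpha>: "\<And>y. y \<in> Q \<Longrightarrow> \<alpha> y \<in> A" and \<beta>: "\<And>y. y \<in> Q \<Longrightarrow> \<beta> y \<in> set_inv\<^bsub>H\<^esub> A"
    and \<alpha>\<beta>: "\<And>y. y \<in> Q \<Longrightarrow> y \<otimes>\<^bsub>H\<^esub> \<alpha> y \<in> h g <#\<^bsub>H\<^esub> Q"
      "\<And>y. y \<in> Q \<Longrightarrow> h g \<otimes>\<^bsub>H\<^esub> y \<otimes>\<^bsub>H\<^esub> \<beta> y \<in> Q"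
    and im: "\<alpha> ` Q \<union> set_inv\<^bsub>H\<^esub> (\<beta> ` Q) = A"
    and ex: "\<And>a. a \<in> A \<Longrightarrow> \<exists>h\<^sub>1\<in>Q. \<exists>h\<^sub>2\<in>Q. h\<^sub>1 \<otimes>\<^bsub>H\<^esub> a \<in> h g <#\<^bsub>H\<^esub> Q \<and>
      h g \<otimes>\<^bsub>H\<^esub> h\<^sub>2 \<otimes>\<^bsub>H\<^esub> inv\<^bsub>H\<^esub> a \<in> Q"
    using data by (simp_all add: commensuration_data_def Pi_iff)
  have Acl: "A \<subseteq> carrier H"
    using sub g by (auto simp: set_mult_def l_coset_def)
  have \<alpha>cl: "\<alpha> y \<in> carrier H" if "y \<in> Q" for y
    using \<alpha>[OF that] Acl by blast
  have \<beta>cl: "\<beta> y \<in> carrier H" "inv\<^bsub>H\<^esub> \<beta> y \<in> A" if y: "y \<in> Q" for y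
  proof -
    obtain a where "a \<in> A" "\<beta> y = inv\<^bsub>H\<^esub> a"
      using \<beta>[OF y] by (auto simp: SET_INV_def)
    then show "\<beta> y \<in> carrier H" "inv\<^bsub>H\<^esub> \<beta> y \<in> A"
      using Acl by auto
  qed
  have sQ: "s y \<in> P" "s y \<in> carrier G" "h (s y) = y" if "y \<in> Q" for y
    using that s[of y] by (simp_all add: P_def)
  \<comment> \<open>Thanks to the section this is an equality; it makes the lifted functions reach
    all the values of \<alpha> and \<beta> on \<open>Q\<close>, as the image condition
    requires.\<close>
  have hP: "h ` P = Q"
  proof
    show "Q \<subseteq> h ` P"
      using sQ by (metis imageI subsetI)
  qed (auto simp: P_def)
  have P_iff: "x \<in> P \<longleftrightarrow> h x \<in> Q" if "x \<in> carrier G" for x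
    using that by (simp add: P_def)
  \<comment> \<open>\<open>g <# P\<close> too is a full preimage, so conditions on lifts reduce to
    the given conditions on \<open>A\<close>.\<close>
  have gP_iff: "x \<in> g <# P \<longleftrightarrow> h x \<in> h g <#\<^bsub>H\<^esub> Q" if "x \<in> carrier G" for x
    using that g P Q by (simp add: G.l_coset_iff H.l_coset_iff P_iff)
  have sA: "s a \<in> carrier G" "h (s a) = a" if "a \<in> A" for a
    using that s Acl by auto
  show "h ` s ` A = A"
    using sA(2) by (simp add: image_image)
  show "h (s (\<alpha> (h x))) = \<alpha> (h x)" if "x \<in> carrier G" "h x \<in> Q" for x
    using that \<alpha> sA by simp
  show "h (inv (s (inv\<^bsub>H\<^esub> \<beta> (h x)))) = \<beta> (h x)" if "x \<in> carrier G" "h x \<in> Q" for x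
    using that \<beta>cl sA by simp
  have "commensuration_data g P G
    (s ` A) (\<lambda>x. s (\<alpha> (h x))) (\<lambda>x. inv (s (inv\<^bsub>H\<^esub> \<beta> (h x))))"
    unfolding commensuration_data_def
  proof (intro conjI ballI)
    show "g \<in> Comm P G"
      unfolding P_def using Q g Comm by (rule Comm_preimage)
    show "finite (s ` A)"
      using fin by simp
    \<comment> \<open>The last condition on the given data supplies \<open>q\<close> moving
      \<open>a\<close> into the left coset of \<open>h g\<close>; its lift \<open>p\<close> moves
      \<open>x\<close> into \<open>g <# P\<close>, and \<open>inv p\<close> brings it back.\<close>
    show "s ` A \<subseteq> P <#> (g <# P)"
    proof
      fix x assume "x \<in> s ` A"
      then obtain a where a: "a \<in> A" "x = s a" by blast
      then obtain q where q: "q \<in> Q" "q \<otimes>\<^bsub>H\<^esub> a \<in> h g <#\<^bsub>H\<^esub> Q"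
        using ex by blast
      define p where "p = s q"
      have p: "p \<in> P" "p \<in> carrier G" "h p = q"
        using sQ[OF q(1)] by (simp_all add: p_def)
      have "p \<otimes> x \<in> g <# P"
        using a p(2,3) q(2) sA[OF a(1)] by (simp add: gP_iff)
      moreover have "x = inv p \<otimes> (p \<otimes> x)"
        using a(2) p(2) sA(1)[OF a(1)] by (simp add: G.l_inv_cancel)
      ultimately show "x \<in> P <#> (g <# P)"
        using subgroup.m_inv_closed[OF P p(1)] unfolding set_mult_def by blast
    qed
    show "(\<lambda>x. s (\<alpha> (h x))) \<in> P \<rightarrow> s ` A"
      using \<alpha> by (simp add: P_def)
    show "(\<lambda>x. inv (s (inv\<^bsub>H\<^esub> \<beta> (h x)))) \<in> P \<rightarrow> set_inv (s ` A)"
      unfolding P_def SET_INV_def using \<beta>cl(2) by blast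
    have "set_inv ((\<lambda>x. inv (s (inv\<^bsub>H\<^esub> \<beta> (h x)))) ` P) = (\<lambda>x. s (inv\<^bsub>H\<^esub> \<beta> (h x))) ` P"
      using \<beta>cl sA by (auto simp: SET_INV_def P_def)
    also have "\<dots> = s ` (set_inv\<^bsub>H\<^esub> (\<beta> ` Q))"
      unfolding hP[symmetric] by (auto simp: SET_INV_def)
    finally show "(\<lambda>x. s (\<alpha> (h x))) ` P \<union> set_inv ((\<lambda>x. inv (s (inv\<^bsub>H\<^esub> \<beta> (h x)))) ` P) = s ` A"
      unfolding im[symmetric] hP[symmetric] by (simp add: image_Un image_image)
  next
    fix x assume "x \<in> P"
    then have x: "x \<in> carrier G" "h x \<in> Q"
      by (simp_all add: P_def)
    then show "x \<otimes> s (\<alpha> (h x)) \<in> g <# P"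
      using \<alpha> \<alpha>\<beta> sA by (simp add: gP_iff)
    show "g \<otimes> x \<otimes> inv (s (inv\<^bsub>H\<^esub> \<beta> (h x))) \<in> P"
      using x g \<beta>cl \<alpha>\<beta> sA by (simp add: P_iff)
  next
    fix x assume "x \<in> s ` A"
    then obtain a where a: "a \<in> A" "x = s a" by blast
    from ex[OF a(1)] obtain q r where q: "q \<in> Q" "q \<otimes>\<^bsub>H\<^esub> a \<in> h g <#\<^bsub>H\<^esub> Q"
      and r: "r \<in> Q" "h g \<otimes>\<^bsub>H\<^esub> r \<otimes>\<^bsub>H\<^esub> inv\<^bsub>H\<^esub> a \<in> Q"
      by (elim bexE conjE)
    have "s q \<otimes> x \<in> g <# P"
      using q(2) sQ(2,3)[OF q(1)] sA[OF a(1)] by (simp add: a(2) gP_iff)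
    moreover have "g \<otimes> s r \<otimes> inv x \<in> P"
      using r(2) sQ(2,3)[OF r(1)] sA[OF a(1)] g by (simp add: a(2) P_iff)
    ultimately show "\<exists>h\<^sub>1\<in>P. \<exists>h\<^sub>2\<in>P. h\<^sub>1 \<otimes> x \<in> g <# P \<and> g \<otimes> h\<^sub>2 \<otimes> inv x \<in> P"
      using sQ(1)[OF q(1)] sQ(1)[OF r(1)] by (intro bexI conjI)
  qed
  then show "commensuration_data g {x \<in> carrier G. h x \<in> Q} G
    (s ` A) (\<lambda>x. s (\<alpha> (h x))) (\<lambda>x. inv (s (inv\<^bsub>H\<^esub> \<beta> (h x))))"
    unfolding P_def .
qed

end

section \<open>Compatible choices along a homomorphism and its image\<close>

theorem lemma12:
  fixes G1 :: "('a, 'm) monoid_scheme" and G2 :: "('b, 'n) monoid_scheme"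
    and f :: "'a \<Rightarrow> 'b" and Q :: "'b set"
  defines "P \<equiv> {x \<in> carrier G1. f x \<in> Q}"
    and "fG1 \<equiv> f ` carrier G1"
  assumes "group G1" and "group G2" and "f \<in> hom G1 G2"
    and "quasi_normal Q G2"
  shows "quasi_normal P G1 \<and>
    quasi_normal (Q \<inter> fG1) (G2\<lparr>carrier := fG1\<rparr>) \<and>
    (\<exists>A1 \<alpha>1 \<beta>1 A2 \<alpha>2 \<beta>2.
      (\<forall>g\<in>carrier G1. commensuration_data g P G1 (A1 g) (\<alpha>1 g) (\<beta>1 g)) \<and>
      (\<forall>y\<in>fG1. commensuration_data y (Q \<inter> fG1) (G2\<lparr>carrier := fG1\<rparr>) (A2 y) (\<alpha>2 y) (\<beta>2 y)) \<and>
      (\<forall>g\<in>carrier G1.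
         f ` A1 g = A2 (f g) \<and>
         (\<forall>q\<in>P. f (\<alpha>1 g q) = \<alpha>2 (f g) (f q)) \<and>
         (\<forall>q\<in>P. f (\<beta>1 g q) = \<beta>2 (f g) (f q)))) \<and>
    (fG1 = carrier G2 \<longrightarrow> Q \<inter> fG1 = Q \<and> G2\<lparr>carrier := fG1\<rparr> = G2)"
proof -
  interpret G1: group G1 by fact
  interpret G2: group G2 by fact
  interpret f: group_hom G1 G2 f
    by unfold_locales fact
  let ?I = "G2\<lparr>carrier := fG1\<rparr>"
  have I: "subgroup fG1 G2"
    unfolding fG1_def by (rule f.img_is_subgroup)
  then interpret I: group ?I
    using G2.subgroup_imp_group by blast
  \<comment> \<open>The preimage of \<open>Q\<close> under the inclusion is
    \<open>Q \<inter> fG1\<close>, so quasi-normality in the image is another case of the preimage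
    result.\<close>
  interpret incl: group_hom ?I G2 "\<lambda>x. x"
    by unfold_locales (use subgroup.subset[OF I] in \<open>auto simp: hom_def\<close>)
  \<comment> \<open>With the image as codomain \<open>f\<close> is onto, so the section demanded by
    the lifting lemma exists.\<close>
  interpret f': group_hom G1 ?I f
    by unfold_locales (use \<open>f \<in> hom G1 G2\<close> in \<open>auto simp: hom_def fG1_def\<close>)
  have qnP: "quasi_normal P G1"
    unfolding P_def using \<open>quasi_normal Q G2\<close> by (rule f.quasi_normal_preimage)
  have "{x \<in> carrier ?I. x \<in> Q} = Q \<inter> fG1"
    by auto
  then have qnI: "quasi_normal (Q \<inter> fG1) ?I"
    using incl.quasi_normal_preimage[OF \<open>quasi_normal Q G2\<close>] by simp
  then have QI: "subgroup (Q \<inter> fG1) ?I" and CommI: "Comm (Q \<inter> fG1) ?I = fG1"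
    by (simp_all add: quasi_normal_def)
  have "\<exists>A \<alpha> \<beta>. commensuration_data y (Q \<inter> fG1) ?I A \<alpha> \<beta>" if "y \<in> fG1" for y
  proof -
    have "y \<in> Comm (Q \<inter> fG1) ?I"
      using that CommI by simp
    from I.commensuration_data_exists[OF QI this] show ?thesis
      by blast
  qed
  \<comment> \<open>Data are chosen for each element \<open>y\<close> of the image before any
    \<open>g\<close> is considered, so they depend on \<open>f g\<close> alone.\<close>
  then obtain A \<alpha> \<beta> where
    data: "\<And>y. y \<in> fG1 \<Longrightarrow> commensuration_data y (Q \<inter> fG1) ?I (A y) (\<alpha> y) (\<beta> y)"
    by metis
  define s where "s = inv_into (carrier G1) f"
  have s: "s y \<in> carrier G1 \<and> f (s y) = y" if "y \<in> carrier ?I" for y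
    using that by (simp add: s_def fG1_def inv_into_into f_inv_into_f)
  \<comment> \<open>The lifting lemma along \<open>f'\<close> speaks of the preimage of
    \<open>Q \<inter> fG1\<close>, which is the same set as \<open>P\<close>.\<close>
  have P: "P = {x \<in> carrier G1. f x \<in> Q \<inter> fG1}"
    by (auto simp: P_def fG1_def)
  have fg: "f g \<in> fG1" if "g \<in> carrier G1" for g
    using that by (simp add: fG1_def)
  define A1 where "A1 g = s ` A (f g)" for g
  define \<alpha>1 where "\<alpha>1 g x = s (\<alpha> (f g) (f x))" for g x
  define \<beta>1 where "\<beta>1 g x = inv\<^bsub>G1\<^esub> (s (inv\<^bsub>?I\<^esub> \<beta> (f g) (f x)))" for g x
  note lift = f'.commensuration_data_lift[OF QI _ data[OF fg] s]
  have "commensuration_data g P G1 (A1 g) (\<alpha>1 g) (\<beta>1 g)" if "g \<in> carrier G1" for g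
    unfolding P A1_def \<alpha>1_def \<beta>1_def by (rule lift(1)[OF that that])
  moreover have "f ` A1 g = A (f g)" if "g \<in> carrier G1" for g
    unfolding A1_def by (rule lift(2)[OF that that])
  moreover have "f (\<alpha>1 g x) = \<alpha> (f g) (f x)" "f (\<beta>1 g x) = \<beta> (f g) (f x)"
    if "g \<in> carrier G1" "x \<in> P" for g x
    unfolding \<alpha>1_def \<beta>1_def using lift(3,4)[OF that(1) that(1)] that(2) by (simp_all add: P)
  moreover have "Q \<inter> fG1 = Q \<and> ?I = G2" if "fG1 = carrier G2"
    using that subgroup.subset[of Q G2] \<open>quasi_normal Q G2\<close> by (auto simp: quasi_normal_def)
  ultimately show ?thesis
    using qnP qnI data
    by (intro conjI exI[of _ A1] exI[of _ \<alpha>1] exI[of _ \<beta>1] exI[of _ A] exI[of _ \<alpha>] exI[of _ \<beta>])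
      simp_all
qed

end
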